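(* Let $\mathcal{X} \subset \mathbb{R}^n$ be bounded, and let $f_c : \mathbb{R}^n \rightarrow \mathbb{R}$ be twice continuously differentiable ($\mathcal{C}^2$) over $\mathcal{X}$. Then for any $\epsilon > 0$ there exists a piecewise-concave approximation $p : \mathbb{R}^n \rightarrow \mathbb{R}$ such that $$\max_{x \in \mathcal{X}} | f_c(x) - p(x) | \leq \epsilon .$$
   Context: A function $p : \mathbb{R}^n \rightarrow \mathbb{R}$ is called piecewise-concave if it is the pointwise maximum of $n_p$ concave functions $p_1, \ldots, p_{n_p}$ (with $n_p$ a positive integer), i.e., $p(x) = \max_{i=1,\ldots,n_p} p_i(x)$, where $x \in \mathbb{R}^n$ is the variable vector.
   Formalization: "C² over X" is taken to mean C² on an open set containing the closure of X (for f = 1/x on X = (0,1) the claim fails otherwise), and the bound on the maximum is read as |f_c(x) − p(x)| ≤ ε for every x in X. *)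

theory Defs
  imports "HOL-Analysis.Analysis"
begin

definition piecewise_concave :: "(real ^ 'n \<Rightarrow> real) \<Rightarrow> bool" where
  "piecewise_concave p \<longleftrightarrow>
     (\<exists>(m::nat) (q :: nat \<Rightarrow> real ^ 'n \<Rightarrow> real).
        m \<ge> 1 \<and> (\<forall>i\<in>{1..m}. concave_on UNIV (q i)) \<and>
        (\<forall>x. p x = Max ((\<lambda>i. q i x) ` {1..m})))"

(* Intended for open U; the derivatives are full (two-sided) Frechet derivatives,
   with f' and f'' valued in spaces of bounded linear maps.  "f is C^2 over X", for X neither
   open nor closed in general, is rendered as C2_on U f for some open U containing closure X;
   U containing only X would not do: 1/x on X = {0<..<1} is unbounded on X, while a
   piecewise-concave function is continuous on the whole space. *)
definition C2_on :: "(real ^ 'n) set \<Rightarrow> (real ^ 'n \<Rightarrow> real) \<Rightarrow> bool" where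
  "C2_on U f \<longleftrightarrow>
     (\<exists>(f' :: real ^ 'n \<Rightarrow> (real ^ 'n) \<Rightarrow>\<^sub>L real)
       (f'' :: real ^ 'n \<Rightarrow> (real ^ 'n) \<Rightarrow>\<^sub>L ((real ^ 'n) \<Rightarrow>\<^sub>L real)).
        (\<forall>x\<in>U. (f has_derivative blinfun_apply (f' x)) (at x)) \<and>
        (\<forall>x\<in>U. (f' has_derivative blinfun_apply (f'' x)) (at x)) \<and>
        continuous_on U f'')"

end

theory Submission
  imports Defs
begin

text \<open>
  Being differentiable near the compact set \<open>K = closure X\<close>, the function \<open>f\<close> is bounded and
  uniformly continuous on \<open>K\<close>. For a steep slope \<open>C\<close>, the downward cone
  \<open>x \<mapsto> f a - C * dist a x\<close> with apex on the graph of \<open>f\<close> is concave, and on \<open>K\<close> it exceeds \<open>f\<close>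
  by at most \<open>\<epsilon>\<close>: near \<open>a\<close> this is uniform continuity, while far from \<open>a\<close> the cone has already
  dropped by at least the total oscillation of \<open>f\<close>. Conversely, if the points \<open>a\<close> form a
  sufficiently fine finite net of \<open>K\<close>, every \<open>x\<close> in \<open>K\<close> lies so close to some \<open>a\<close> that \<open>f a\<close> is
  close to \<open>f x\<close> and the cone has hardly dropped, so the maximum of the cones is at least \<open>f - \<epsilon>\<close>.
  This maximum of finitely many cones is the required approximation
  (\<open>continuous_on_compact_approx_piecewise_concave\<close>).
\<close>

lemma piecewise_concave_Max_image:
  fixes g :: "'a \<Rightarrow> real ^ 'n \<Rightarrow> real"
  assumes "finite A" "A \<noteq> {}" and conc: "\<And>a. a \<in> A \<Longrightarrow> concave_on UNIV (g a)"
  shows "piecewise_concave (\<lambda>x. Max ((\<lambda>a. g a x) ` A))"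
proof -
  obtain h where h: "bij_betw h {1..card A} A"
    using ex_bij_betw_nat_finite_1[OF \<open>finite A\<close>] by blast
  have img: "h ` {1..card A} = A"
    using h by (simp add: bij_betw_def)
  have "card A \<ge> 1"
    using assms(1,2) by (simp add: Suc_leI card_gt_0_iff)
  moreover have "\<forall>i\<in>{1..card A}. concave_on UNIV (g (h i))"
    using conc img by blast
  moreover have "(\<lambda>a. g a x) ` A = (\<lambda>i. g (h i) x) ` {1..card A}" for x
    by (subst img[symmetric]) (simp add: image_image)
  ultimately show ?thesis
    unfolding piecewise_concave_def by (intro exI[of _ "card A"] exI[of _ "\<lambda>i. g (h i)"]) simp
qed

lemma concave_on_cone:
  fixes a :: "'a::real_normed_vector"
  assumes "C \<ge> 0" "convex S"
  shows "concave_on S (\<lambda>x. c - C * dist a x)"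
proof -
  have "convex_on S (\<lambda>x. C * dist a x + - c)"
    using assms by (intro convex_on_add convex_on_cmul convex_on_dist) (auto simp: convex_on_const)
  then show ?thesis
    by (simp add: concave_on_def)
qed

text \<open>
  The constants are chosen in the order \<open>\<delta>\<close>, \<open>C\<close>, \<open>r\<close>: the modulus of continuity determines how
  steep the cones must be, and the steepness determines how fine the net of apexes must be.
\<close>

lemma continuous_on_compact_approx_piecewise_concave:
  fixes f :: "real ^ 'n \<Rightarrow> real"
  assumes "compact K" "continuous_on K f" "\<epsilon> > 0"
  obtains p where "piecewise_concave p" "\<And>x. x \<in> K \<Longrightarrow> \<bar>f x - p x\<bar> \<le> \<epsilon>"
proof (cases "K = {}")
  case True
  have "piecewise_concave (\<lambda>x. Max ((\<lambda>a. (0::real) - 0 * dist a x) ` {0 :: real ^ 'n}))"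
    by (intro piecewise_concave_Max_image concave_on_cone) auto
  then show ?thesis
    using True that by blast
next
  case False
  obtain \<delta> where "\<delta> > 0"
    and \<delta>: "\<And>x y. x \<in> K \<Longrightarrow> y \<in> K \<Longrightarrow> dist y x < \<delta> \<Longrightarrow> \<bar>f y - f x\<bar> < \<epsilon> / 2"
    using compact_uniformly_continuous[OF assms(2,1)] \<open>\<epsilon> > 0\<close>
    unfolding uniformly_continuous_on_def dist_real_def by (metis half_gt_zero)
  obtain M where "M > 0" and M: "\<And>x. x \<in> K \<Longrightarrow> \<bar>f x\<bar> \<le> M"
    using compact_imp_bounded[OF compact_continuous_image[OF assms(2,1)]]
    unfolding bounded_pos by auto
  \<comment> \<open>Steep enough that a cone drops by the oscillation bound \<open>2 * M\<close> within distance \<open>\<delta>\<close>.\<close>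
  define C where "C = 2 * M / \<delta>"
  have "C > 0" and C\<delta>: "C * \<delta> = 2 * M"
    using \<open>M > 0\<close> \<open>\<delta> > 0\<close> by (auto simp: C_def)
  define r where "r = min \<delta> (\<epsilon> / (2 * C))"
  have "r > 0" "r \<le> \<delta>" and Cr: "C * r \<le> \<epsilon> / 2"
    using \<open>C > 0\<close> \<open>\<delta> > 0\<close> \<open>\<epsilon> > 0\<close> by (auto simp: r_def field_simps min_def)
  obtain A where A: "finite A" "A \<subseteq> K" "K \<subseteq> (\<Union>a\<in>A. ball a r)"
    using compactE_image[OF \<open>compact K\<close>, of K "\<lambda>a. ball a r"] \<open>r > 0\<close>
    by (metis UN_I centre_in_ball open_ball subsetI)
  have "A \<noteq> {}"
    using A(3) False by auto
  define cone where "cone a x = f a - C * dist a x" for a x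
  define p where "p x = Max ((\<lambda>a. cone a x) ` A)" for x
  have "piecewise_concave p"
    unfolding p_def cone_def using A(1) \<open>A \<noteq> {}\<close> \<open>C > 0\<close>
    by (intro piecewise_concave_Max_image concave_on_cone) auto
  moreover have "\<bar>f x - p x\<bar> \<le> \<epsilon>" if "x \<in> K" for x
  proof -
    have "cone a x \<le> f x + \<epsilon>" if "a \<in> A" for a
    proof (cases "dist a x < \<delta>")
      case True
      have "\<bar>f a - f x\<bar> < \<epsilon> / 2"
        using \<delta>[of x a] True \<open>a \<in> A\<close> A(2) \<open>x \<in> K\<close> by blast
      moreover have "C * dist a x \<ge> 0"
        using \<open>C > 0\<close> by simp
      ultimately show ?thesis
        using \<open>\<epsilon> > 0\<close> unfolding cone_def by linarith
    next
      case False
      then have "C * dist a x \<ge> 2 * M"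
        using \<open>C > 0\<close> by (simp flip: C\<delta>)
      moreover have "\<bar>f a\<bar> \<le> M" "\<bar>f x\<bar> \<le> M"
        using M \<open>a \<in> A\<close> A(2) \<open>x \<in> K\<close> by auto
      ultimately show ?thesis
        using \<open>\<epsilon> > 0\<close> unfolding cone_def by linarith
    qed
    then have "p x \<le> f x + \<epsilon>"
      using A(1) \<open>A \<noteq> {}\<close> by (simp add: p_def)
    moreover obtain a where "a \<in> A" "dist a x < r"
      using A(3) \<open>x \<in> K\<close> by auto
    then have "C * dist a x \<le> C * r" "\<bar>f a - f x\<bar> < \<epsilon> / 2"
      using \<open>C > 0\<close> \<delta>[of x a] A(2) \<open>x \<in> K\<close> \<open>r \<le> \<delta>\<close> by auto
    then have "f x - \<epsilon> \<le> cone a x"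
      using Cr unfolding cone_def by linarith
    moreover have "cone a x \<le> p x"
      using A(1) \<open>a \<in> A\<close> by (simp add: p_def)
    ultimately show ?thesis
      by linarith
  qed
  ultimately show ?thesis
    using that by blast
qed

theorem theorem1:
  fixes X U :: "(real ^ 'n) set" and f :: "real ^ 'n \<Rightarrow> real" and \<epsilon> :: real
  assumes "bounded X"
    and "open U" and "closure X \<subseteq> U" and "C2_on U f"
    and "\<epsilon> > 0"
  shows "\<exists>p. piecewise_concave p \<and> (\<forall>x\<in>X. \<bar>f x - p x\<bar> \<le> \<epsilon>)"
proof -
  have "continuous_on U f"
    using \<open>C2_on U f\<close> unfolding C2_on_def
    by (meson continuous_at_imp_continuous_on has_derivative_continuous)
  then have "continuous_on (closure X) f"
    using \<open>closure X \<subseteq> U\<close> continuous_on_subset by blast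
  moreover have "compact (closure X)"
    using \<open>bounded X\<close> by simp
  ultimately obtain p where "piecewise_concave p" "\<And>x. x \<in> closure X \<Longrightarrow> \<bar>f x - p x\<bar> \<le> \<epsilon>"
    using continuous_on_compact_approx_piecewise_concave \<open>\<epsilon> > 0\<close> by metis
  then show ?thesis
    using closure_subset by blast
qed

end
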